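(* Let $J$ be a Jordan curve in $\mathbb{C}$ and let $\delta>0$ be a real number. Denote by $I$ the bounded component of $\hat{\mathbb{C}}\setminus J$ and by $O$ the unbounded component of $\hat{\mathbb{C}}\setminus J$ (the one containing $\infty$). Then there exists a polynomial $P:\hat{\mathbb{C}}\to\hat{\mathbb{C}}$ (with $\infty$ an attracting fixed point, so that the sets below are defined) such that (i) $d_H(I,\mathcal{K}(P))<\delta$; (ii) $d_H(J,\mathcal{J}(P))<\delta$; and (iii) $d_H(O,\mathcal{L}(P))<\delta$.
   Context: $\hat{\mathbb{C}}=\mathbb{C}\cup\{\infty\}$ is the Riemann sphere. For a rational map $f$ of $\hat{\mathbb{C}}$ for which $\infty$ is an attracting fixed point: $\mathcal{L}(f)$ is the basin of attraction of $\infty$ for $f$ (the set of points whose forward iterates converge to $\infty$), $\mathcal{K}(f)=\hat{\mathbb{C}}\setminus\mathcal{L}(f)$, and $\mathcal{J}(f)=\partial\mathcal{K}(f)$. (For a polynomial, $\mathcal{J}(f)$ is the Julia set and $\mathcal{K}(f)$ the filled Julia set.) For nonempty $X,Y\subset\mathbb{C}$, the Hausdorff distance is $d_H(X,Y)=\inf\{\epsilon>0: X\subseteq N_\epsilon(Y)\text{ and }Y\subseteq N_\epsilon(X)\}$, where $N_\epsilon(X)=\bigcup_{x\in X}\{z: d(z,x)\le\epsilon\}$ and $d$ is the Euclidean distance. If $X,Y\subset\hat{\mathbb{C}}$ both contain an open ball about $\infty$, then $d_H(X,Y)$ means $d_H(X\setminus B,Y\setminus B)$, where $B=\{|z|>R\}\cup\{\infty\}$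 is a sufficiently small such ball (i.e. $R$ sufficiently large) contained in both $X$ and $Y$; the value does not depend on $R$ once $R$ is large enough. *)

theory Defs
  imports
    "HOL-Analysis.Analysis"
    "HOL-Computational_Algebra.Polynomial"
begin

section \<open>The Riemann sphere\<close>

text \<open>
  The sphere is the one-point compactification of the plane: \<open>Some z\<close> is the finite
  point \<open>z\<close>, and \<open>None\<close> is the point at infinity.
\<close>

type_synonym riemann_sphere = "complex option"

abbreviation sphere_top :: "riemann_sphere topology" where
  "sphere_top \<equiv> Alexandroff_compactification euclidean"

definition finite_part :: "riemann_sphere set \<Rightarrow> complex set" where
  "finite_part X = {z. Some z \<in> X}"

definition ball_at_infinity :: "real \<Rightarrow> riemann_sphere set" where
  "ball_at_infinity R = insert None (Some ` {z. cmod z > R})"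

section \<open>Polynomials acting on the sphere, and attraction to infinity\<close>

fun poly_map :: "complex poly \<Rightarrow> riemann_sphere \<Rightarrow> riemann_sphere" where
  "poly_map p (Some z) = Some (poly p z)"
| "poly_map p None = (if degree p = 0 then Some (coeff p 0) else None)"

text \<open>
  The map \<open>f\<close> read in the coordinate \<open>w = 1/z\<close>, in which infinity is \<open>w = 0\<close>.  Only the
  germ at \<open>w = 0\<close> matters, so for \<open>f\<close> continuous with \<open>f \<infinity> = \<infinity>\<close> the value at points that
  \<open>f\<close> maps to the finite point \<open>0\<close> (where \<open>inverse 0 = 0\<close>) is irrelevant.
\<close>

definition at_infinity_chart :: "(riemann_sphere \<Rightarrow> riemann_sphere) \<Rightarrow> complex \<Rightarrow> complex" where
  "at_infinity_chart f w =
     (case f (if w = 0 then None else Some (inverse w)) of None \<Rightarrow> 0 | Some z \<Rightarrow> inverse z)"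

definition infinity_attracting :: "(riemann_sphere \<Rightarrow> riemann_sphere) \<Rightarrow> bool" where
  "infinity_attracting f \<longleftrightarrow>
     f None = None \<and>
     (\<exists>m. (at_infinity_chart f has_field_derivative m) (at 0) \<and> cmod m < 1)"

definition basin_infinity :: "(riemann_sphere \<Rightarrow> riemann_sphere) \<Rightarrow> riemann_sphere set" where
  "basin_infinity f = {z. limitin sphere_top (\<lambda>n. (f ^^ n) z) None sequentially}"

definition filled_julia :: "(riemann_sphere \<Rightarrow> riemann_sphere) \<Rightarrow> riemann_sphere set" where
  "filled_julia f = UNIV - basin_infinity f"

definition julia :: "(riemann_sphere \<Rightarrow> riemann_sphere) \<Rightarrow> riemann_sphere set" where
  "julia f = sphere_top frontier_of filled_julia f"

section \<open>Hausdorff distance\<close>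

definition closed_nbhd :: "real \<Rightarrow> complex set \<Rightarrow> complex set" where
  "closed_nbhd e X = (\<Union>x\<in>X. cball x e)"

text \<open>
  Extended real values, so that the infimum over an empty set of radii is \<open>\<infinity>\<close> rather than
  an unspecified real number.
\<close>

definition hausdorff_dist :: "complex set \<Rightarrow> complex set \<Rightarrow> ereal" where
  "hausdorff_dist X Y =
     (INF e\<in>{e::real. e > 0 \<and> X \<subseteq> closed_nbhd e Y \<and> Y \<subseteq> closed_nbhd e X}. ereal e)"

text \<open>
  For sets containing a ball about infinity: the common value, for all large \<open>R\<close>, of the distance
  after removal of the ball of radius \<open>R\<close> about infinity.  It exists and is unique by
  \<open>hausdorff_dist_infinity_well_defined\<close> below.
\<close>

definition hausdorff_dist_infinity :: "riemann_sphere set \<Rightarrow> riemann_sphere set \<Rightarrow> ereal" where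
  "hausdorff_dist_infinity X Y =
     (THE d. \<forall>\<^sub>F R in at_top.
        ball_at_infinity R \<subseteq> X \<inter> Y \<and>
        hausdorff_dist (finite_part (X - ball_at_infinity R))
                       (finite_part (Y - ball_at_infinity R)) = d)"

lemma finite_part_truncate:
  "finite_part (X - ball_at_infinity R) = {z. Some z \<in> X \<and> cmod z \<le> R}"
  by (auto simp: finite_part_def ball_at_infinity_def)

lemma truncated_nbhd_mono:
  assumes Y: "ball_at_infinity r \<subseteq> Y" and "r > 0" "e > 0"
    and R: "R \<ge> 3 * r + 1" and R': "R' \<ge> 3 * r + 1"
    and sub: "finite_part (X - ball_at_infinity R) \<subseteq>
              closed_nbhd e (finite_part (Y - ball_at_infinity R))"
  shows "finite_part (X - ball_at_infinity R') \<subseteq>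
         closed_nbhd e (finite_part (Y - ball_at_infinity R'))"
proof
  fix z assume "z \<in> finite_part (X - ball_at_infinity R')"
  then have z: "Some z \<in> X" "cmod z \<le> R'" by (auto simp: finite_part_truncate)
  have far: "Some y \<in> Y" if "cmod y > r" for y
    using Y that by (auto simp: ball_at_infinity_def)
  have "\<exists>y. Some y \<in> Y \<and> cmod y \<le> R' \<and> dist y z \<le> e"
  proof (cases "cmod z > r")
    case True
    then show ?thesis using far z \<open>e > 0\<close> by (intro exI[of _ z]) auto
  next
    case False
    then have "z \<in> finite_part (X - ball_at_infinity R)"
      using z R \<open>r > 0\<close> by (auto simp: finite_part_truncate)
    then obtain y where y: "Some y \<in> Y" "cmod y \<le> R" "dist y z \<le> e"
      using sub by (fastforce simp: finite_part_truncate closed_nbhd_def)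
    show ?thesis
    proof (cases "cmod y \<le> R'")
      case True
      then show ?thesis using y by blast
    next
      case big: False
      define w where "w = complex_of_real (r + 1)"
      have w: "cmod w = r + 1" using \<open>r > 0\<close> unfolding w_def norm_of_real by simp
      have "dist w z \<le> cmod w + cmod z" by (simp add: dist_norm norm_triangle_ineq4)
      moreover have "cmod y - cmod z \<le> dist y z" by (simp add: dist_norm norm_triangle_ineq2)
      ultimately have "dist w z \<le> e" using w big False y R' by linarith
      then show ?thesis using far[of w] w R' \<open>r > 0\<close> by (intro exI[of _ w]) auto
    qed
  qed
  then show "z \<in> closed_nbhd e (finite_part (Y - ball_at_infinity R'))"
    by (auto simp: finite_part_truncate closed_nbhd_def)
qed

lemma hausdorff_dist_infinity_well_defined:
  assumes "ball_at_infinity r \<subseteq> X \<inter> Y"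
  shows "\<exists>!d. \<forall>\<^sub>F R in at_top.
           ball_at_infinity R \<subseteq> X \<inter> Y \<and>
           hausdorff_dist (finite_part (X - ball_at_infinity R))
                          (finite_part (Y - ball_at_infinity R)) = d"
proof -
  define s where "s = max r 1"
  have s: "ball_at_infinity s \<subseteq> X" "ball_at_infinity s \<subseteq> Y" "s > 0"
    using assms by (auto simp: s_def ball_at_infinity_def)
  let ?h = "\<lambda>R. hausdorff_dist (finite_part (X - ball_at_infinity R))
                               (finite_part (Y - ball_at_infinity R))"
  have eq: "?h R = ?h (3 * s + 1)" if R: "R \<ge> 3 * s + 1" for R
  proof -
    note mono = truncated_nbhd_mono[OF s(2) s(3)] truncated_nbhd_mono[OF s(1) s(3)]
    show ?thesis
      unfolding hausdorff_dist_def
      by (rule arg_cong[where f = "\<lambda>A. INF e\<in>A. ereal e"])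
        (use R in \<open>auto intro!: Collect_cong conj_cong dest: mono[where R' = R] mono[where R' = "3 * s + 1"] del: subsetI\<close>)
  qed
  have sub: "ball_at_infinity R \<subseteq> X \<inter> Y" if "R \<ge> 3 * s + 1" for R
    using s that by (auto simp: ball_at_infinity_def)
  show ?thesis
  proof (rule ex_ex1I)
    show "\<exists>d. \<forall>\<^sub>F R in at_top. ball_at_infinity R \<subseteq> X \<inter> Y \<and> ?h R = d"
      using eq sub by (intro exI[of _ "?h (3 * s + 1)"] eventually_mono[OF eventually_ge_at_top]) blast
  next
    fix d d'
    assume "\<forall>\<^sub>F R in at_top. ball_at_infinity R \<subseteq> X \<inter> Y \<and> ?h R = d"
      "\<forall>\<^sub>F R in at_top. ball_at_infinity R \<subseteq> X \<inter> Y \<and> ?h R = d'"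
    then have "\<forall>\<^sub>F R::real in at_top. d = d'" by eventually_elim auto
    then show "d = d'" by simp
  qed
qed

section \<open>Jordan curves\<close>

definition jordan_curve :: "complex set \<Rightarrow> bool" where
  "jordan_curve J \<longleftrightarrow>
     (\<exists>\<gamma>. simple_path \<gamma> \<and> pathfinish \<gamma> = pathstart \<gamma> \<and> path_image \<gamma> = J)"

definition sphere_complement_components :: "complex set \<Rightarrow> riemann_sphere set set" where
  "sphere_complement_components J =
     connected_components_of (subtopology sphere_top (UNIV - Some ` J))"

end

theory Submission
  imports Defs "HOL-Complex_Analysis.Complex_Analysis"
begin

text \<open>
  A polynomial \<open>p(z) = a + (z - a) \<omega>(z)\<close>, with \<open>a\<close> inside \<open>J\<close>, has a filled Julia set close to the closed
  Jordan domain as soon as \<open>\<omega>\<close> is very small on that domain and very large on the exterior points at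
  distance at least \<open>\<eta>\<close> from \<open>J\<close>: the domain is then mapped into a small disc about \<open>a\<close> and never escapes,
  while the orbits of those exterior points are pushed away from \<open>a\<close> and converge to infinity
  (\<open>polynomial_with_prescribed_basin\<close>).  The points with undetermined fate lie within \<open>\<eta>\<close> of \<open>J\<close>, and every
  point of \<open>J\<close> is close both to trapped and to escaping points; for small \<open>\<eta>\<close> this yields all three
  Hausdorff estimates.

  The polynomial \<open>\<omega>\<close> (\<open>separating_polynomial\<close>) is a multiple of a Faber polynomial of high degree.
  Inversion at \<open>a\<close> turns the exterior of \<open>J\<close> into a bounded simply connected domain, with a Riemann map
  \<open>\<psi>\<close> from the unit disc fixing the origin (\<open>exterior_Riemann_map\<close>).  The Faber polynomial
  of index \<open>m\<close> in \<open>x = z - a\<close> is the Taylor coefficient of index \<open>m\<close> at \<open>u = 0\<close> of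
  \<open>x \<psi>'(u) / (1 - x \<psi>(u))\<close>.  For \<open>z\<close> inside or on \<open>J\<close> this function of \<open>u\<close> is holomorphic in the whole disc
  (\<open>norm_faber_poly_inner\<close>), whereas for the exterior point with \<open>1 / x = \<psi> v\<close> it has a simple pole at
  \<open>v\<close>, which contributes \<open>1 / v ^ (m + 1)\<close> (\<open>norm_faber_poly_outer\<close>).  By Cauchy's inequality everything else is
  \<open>O(r ^ (- m))\<close> with \<open>r\<close> as close to \<open>1\<close> as desired, so exterior points with \<open>\<bar>v\<bar> < r\<close> are separated
  exponentially in \<open>m\<close> from the closed Jordan domain.
\<close>

section \<open>Faber polynomials of a univalent function\<close>

text \<open>
  For a univalent \<open>\<psi>\<close> on the unit disc with \<open>\<psi> 0 = 0\<close> and inverse \<open>\<phi>\<close>, this is the principal part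
  at \<open>w = 0\<close> of \<open>1 / \<phi> w ^ (m + 1)\<close>, as a polynomial in \<open>1 / w\<close>.  The
  coefficients come from the generating function
  \<open>x \<psi>'(u) / (1 - x \<psi>(u)) = (\<Sum>k. x ^ (k + 1) \<psi>'(u) \<psi>(u) ^ k)\<close>: its coefficient of \<open>u ^ m\<close> is a
  polynomial in \<open>x\<close>, since \<open>\<psi>(u) ^ k\<close> vanishes to order \<open>k\<close> at the origin.
\<close>

definition faber_poly :: "(complex \<Rightarrow> complex) \<Rightarrow> nat \<Rightarrow> complex poly" where
  "faber_poly \<psi> m =
     (\<Sum>k\<le>m. monom (fps_nth (fps_deriv (fps_expansion \<psi> 0) * fps_expansion \<psi> 0 ^ k) m) (Suc k))"

text \<open>
  The equation for \<open>A\<close> is a fixed point equation \<open>A = x \<Psi>' + A (x \<Psi>)\<close>.  After \<open>m + 1\<close> substitutions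
  the remainder carries the factor \<open>\<Psi> ^ (m + 1)\<close> and does not reach the coefficient of index \<open>m\<close>.
\<close>

lemma faber_poly_generating_function:
  fixes \<psi> :: "complex \<Rightarrow> complex" and A :: "complex fps" and x :: complex
  defines "\<Psi> \<equiv> fps_expansion \<psi> 0"
  assumes "fps_nth \<Psi> 0 = 0"
    and A: "A * (1 - fps_const x * \<Psi>) = fps_const x * fps_deriv \<Psi>"
  shows "fps_nth A m = poly (faber_poly \<psi> m) x"
proof -
  have step: "A = fps_const x * fps_deriv \<Psi> + A * (fps_const x * \<Psi>)"
    using A by (simp add: algebra_simps)
  have "A = (\<Sum>k\<le>j. fps_const (x ^ Suc k) * (fps_deriv \<Psi> * \<Psi> ^ k))
              + A * (fps_const (x ^ Suc j) * \<Psi> ^ Suc j)" for j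
  proof (induction j)
    case 0
    then show ?case using step by simp
  next
    case (Suc j)
    have "A * (fps_const (x ^ Suc j) * \<Psi> ^ Suc j)
       = (fps_const x * fps_deriv \<Psi> + A * (fps_const x * \<Psi>)) * (fps_const (x ^ Suc j) * \<Psi> ^ Suc j)"
      using step by simp
    also have "\<dots> = fps_const (x ^ Suc (Suc j)) * (fps_deriv \<Psi> * \<Psi> ^ Suc j)
       + A * (fps_const (x ^ Suc (Suc j)) * \<Psi> ^ Suc (Suc j))"
      by (simp add: algebra_simps flip: fps_const_mult)
    finally show ?case using Suc by (simp add: add.assoc)
  qed
  from this[of m] have "fps_nth A m =
      fps_nth ((\<Sum>k\<le>m. fps_const (x ^ Suc k) * (fps_deriv \<Psi> * \<Psi> ^ k))
              + A * (fps_const (x ^ Suc m) * \<Psi> ^ Suc m)) m" by simp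
  also have "\<dots> = (\<Sum>k\<le>m. x ^ Suc k * fps_nth (fps_deriv \<Psi> * \<Psi> ^ k) m)
              + fps_nth (A * (fps_const (x ^ Suc m) * \<Psi> ^ Suc m)) m"
    by (simp add: fps_sum_nth del: power_Suc)
  also have "fps_nth (A * (fps_const (x ^ Suc m) * \<Psi> ^ Suc m)) m = 0"
    using startsby_zero_power_prefix[OF \<open>fps_nth \<Psi> 0 = 0\<close>, of "Suc m"]
    by (simp add: fps_mult_nth[of A] del: power_Suc)
  finally show ?thesis
    by (simp add: faber_poly_def \<Psi>_def poly_sum poly_monom mult_ac del: power_Suc)
qed

lemma norm_fps_nth_le:
  assumes hol: "f holomorphic_on ball 0 1" and exp: "f has_fps_expansion F" and "0 < r" "r < 1"
    and B: "\<And>u. norm u = r \<Longrightarrow> norm (f u) \<le> B"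
  shows "norm (fps_nth F m) \<le> B / r ^ m"
proof -
  have sub: "cball 0 r \<subseteq> (ball 0 1 :: complex set)" using \<open>r < 1\<close> by auto
  have "norm ((deriv ^^ m) f 0) \<le> fact m * B / r ^ m"
  proof (rule Cauchy_inequality)
    show "f holomorphic_on ball 0 r"
      by (rule holomorphic_on_subset[OF hol]) (use \<open>r < 1\<close> in auto)
    show "continuous_on (cball 0 r) f"
      using holomorphic_on_imp_continuous_on holomorphic_on_subset[OF hol sub] by blast
  qed (use assms in auto)
  then have "norm ((deriv ^^ m) f 0) / fact m \<le> B / r ^ m"
    by (simp add: field_simps)
  then show ?thesis
    using fps_nth_fps_expansion[OF exp, of m] by (simp add: norm_divide)
qed

context
  fixes \<psi> :: "complex \<Rightarrow> complex"
  assumes holo: "\<psi> holomorphic_on ball 0 1" and zero: "\<psi> 0 = 0"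
begin

lemma has_own_fps_expansion: "\<psi> has_fps_expansion fps_expansion \<psi> 0"
  using holo by (intro has_fps_expansion_fps_expansion[of "ball 0 1"]) auto

text \<open>
  The Faber polynomials are Taylor coefficients of a function of \<open>u\<close>, so that Cauchy's inequality
  applies to them wherever that function has no pole.
\<close>

lemma faber_kernel_expansion:
  obtains A where "(\<lambda>u. x * deriv \<psi> u / (1 - x * \<psi> u)) has_fps_expansion A"
    and "\<And>m. fps_nth A m = poly (faber_poly \<psi> m) x"
proof -
  let ?P = "fps_expansion \<psi> 0"
  have P0: "fps_nth ?P 0 = 0" using zero by (simp add: fps_expansion_def)
  define D where "D = 1 - fps_const x * ?P"
  have D0: "fps_nth D 0 \<noteq> 0" by (simp add: D_def P0)
  have "(\<lambda>u. x * deriv \<psi> u / (1 - x * \<psi> u)) has_fps_expansion (fps_const x * fps_deriv ?P) / D"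
    using D0 unfolding D_def
    by (intro fps_expansion_intros has_own_fps_expansion) auto
  moreover have "(fps_const x * fps_deriv ?P) / D * D = fps_const x * fps_deriv ?P"
    using D0 by (simp add: fps_divide_unit mult.assoc inverse_mult_eq_1)
  ultimately show ?thesis
    using faber_poly_generating_function[of \<psi>] P0 that unfolding D_def by blast
qed

text \<open>
  If \<open>1 / x\<close> lies off the image of \<open>\<psi>\<close>, the generating function has no pole in the disc, and the
  Faber polynomials grow at most like \<open>r ^ (- m)\<close>.
\<close>

lemma norm_faber_poly_inner:
  assumes "0 < r" "r < 1" and ne: "\<And>u. u \<in> ball 0 1 \<Longrightarrow> x * \<psi> u \<noteq> 1"
    and B: "\<And>u. norm u = r \<Longrightarrow> norm (x * deriv \<psi> u / (1 - x * \<psi> u)) \<le> B"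
  shows "norm (poly (faber_poly \<psi> m) x) \<le> B / r ^ m"
proof -
  let ?f = "\<lambda>u. x * deriv \<psi> u / (1 - x * \<psi> u)"
  obtain A where A: "?f has_fps_expansion A" "\<And>m. fps_nth A m = poly (faber_poly \<psi> m) x"
    using faber_kernel_expansion by blast
  have hol: "?f holomorphic_on ball 0 1"
    using holo ne by (intro holomorphic_intros) fastforce+
  show ?thesis
    using norm_fps_nth_le[OF hol A(1) \<open>0 < r\<close> \<open>r < 1\<close> B, of m] A(2) by simp
qed

text \<open>
  If \<open>1 / x = \<psi> v\<close>, the generating function has one simple pole, at \<open>u = v\<close>.  Writing
  \<open>\<psi> u - \<psi> v = d(u) (u - v)\<close> with \<open>d\<close> zero-free by univalence, logarithmic differentiation gives
  \<open>\<psi>'(u) / (\<psi> v - \<psi> u) = 1 / (v - u) - d'(u) / d(u)\<close>.  The first summand contributes \<open>1 / v ^ (m + 1)\<close>,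
  and the second is holomorphic in the disc, so Cauchy's inequality bounds its coefficients.
\<close>

lemma norm_faber_poly_outer:
  assumes inj: "inj_on \<psi> (ball 0 1)" and "v \<noteq> 0" "norm v < r" "r < 1"
    and B: "\<And>u. norm u = r \<Longrightarrow> norm (deriv \<psi> u / (\<psi> v - \<psi> u) - 1 / (v - u)) \<le> B"
  shows "norm (poly (faber_poly \<psi> m) (1 / \<psi> v) - 1 / v ^ Suc m) \<le> B / r ^ m"
proof -
  have vb: "v \<in> ball 0 1" using assms by auto
  have "0 < r" using \<open>norm v < r\<close> norm_ge_zero[of v] by linarith
  have "\<psi> v \<noteq> 0" using inj zero \<open>v \<noteq> 0\<close> vb by (metis centre_in_ball inj_onD zero_less_one)
  define x where "x = 1 / \<psi> v"
  let ?f = "\<lambda>u. x * deriv \<psi> u / (1 - x * \<psi> u)"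
  have f_eq: "?f u = deriv \<psi> u / (\<psi> v - \<psi> u)" for u
    using \<open>\<psi> v \<noteq> 0\<close> by (simp add: x_def field_simps)
  define d where "d = (\<lambda>u. if u = v then deriv \<psi> v else (\<psi> u - \<psi> v) / (u - v))"
  have d_hol: "d holomorphic_on ball 0 1"
    unfolding d_def using pole_lemma_open[OF holo] by simp
  have d_ne: "d u \<noteq> 0" if "u \<in> ball 0 1" for u
    using holomorphic_injective_imp_regular[OF holo _ inj vb] inj that vb
    by (auto simp: d_def inj_on_eq_iff)
  define R where "R = (\<lambda>u. - deriv d u / d u)"
  have R_hol: "R holomorphic_on ball 0 1"
    unfolding R_def using d_hol d_ne by (intro holomorphic_intros) auto
  have R_eq: "R u = ?f u - 1 / (v - u)" if u: "u \<in> ball 0 1 - {v}" for u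
  proof -
    have "\<psi> = (\<lambda>u. \<psi> v + d u * (u - v))" by (auto simp: d_def)
    moreover have "((\<lambda>u. \<psi> v + d u * (u - v)) has_field_derivative
        (deriv d u * (u - v) + d u)) (at u)"
      using holomorphic_derivI[OF d_hol, of u] u by (auto intro!: derivative_eq_intros)
    ultimately have "deriv \<psi> u = deriv d u * (u - v) + d u"
      by (metis DERIV_imp_deriv)
    moreover have "\<psi> v - \<psi> u = d u * (v - u)" using u by (auto simp: d_def field_simps)
    ultimately show ?thesis
      using u d_ne[of u] unfolding f_eq R_def by (auto simp: divide_simps) (auto simp: algebra_simps)
  qed
  obtain A where A: "?f has_fps_expansion A" "\<And>m. fps_nth A m = poly (faber_poly \<psi> m) x"
    using faber_kernel_expansion by blast
  define E where "E = Abs_fps (\<lambda>n. 1 / v ^ Suc n)"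
  have E1: "E * (fps_const v - fps_X) = 1"
  proof (rule fps_ext)
    fix n show "fps_nth (E * (fps_const v - fps_X)) n = fps_nth 1 n"
      using \<open>v \<noteq> 0\<close> by (cases n) (auto simp: algebra_simps E_def)
  qed
  have "(\<lambda>u. 1 / (v - u)) has_fps_expansion 1 / (fps_const v - fps_X)"
    using \<open>v \<noteq> 0\<close> by (intro fps_expansion_intros) auto
  moreover have "1 / (fps_const v - fps_X) = E"
    using E1 \<open>v \<noteq> 0\<close> by (metis dvd_triv_right nonzero_mult_div_cancel_right mult_zero_right zero_neq_one)
  ultimately have "(\<lambda>u. ?f u - 1 / (v - u)) has_fps_expansion A - E"
    using A(1) by (intro fps_expansion_intros) auto
  moreover have "eventually (\<lambda>u. u \<in> ball 0 1 - {v}) (nhds 0)"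
    using \<open>v \<noteq> 0\<close> by (intro eventually_nhds_in_open) auto
  then have "eventually (\<lambda>u. R u = ?f u - 1 / (v - u)) (nhds 0)"
    by eventually_elim (use R_eq in auto)
  ultimately have "R has_fps_expansion A - E"
    using has_fps_expansion_cong by fastforce
  moreover have "norm (R u) \<le> B" if "norm u = r" for u
  proof -
    have "u \<in> ball 0 1 - {v}" using that assms by auto
    then show ?thesis using B[OF that] R_eq[of u] unfolding f_eq by simp
  qed
  ultimately have "norm (fps_nth (A - E) m) \<le> B / r ^ m"
    using norm_fps_nth_le[OF R_hol] \<open>0 < r\<close> \<open>r < 1\<close> by blast
  then show ?thesis
    by (simp add: A(2) E_def x_def)
qed

end


section \<open>The Riemann map of the exterior of a Jordan curve\<close>

lemma Riemann_mapping_normalized: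
  assumes "open S" "simply_connected S" "0 \<in> S" "S \<noteq> UNIV"
  obtains \<phi> \<psi> where "\<phi> holomorphic_on S" "\<psi> holomorphic_on ball 0 1" "\<psi> 0 = 0"
    and "\<And>w. w \<in> S \<Longrightarrow> \<phi> w \<in> ball 0 1 \<and> \<psi> (\<phi> w) = w"
    and "\<And>u. u \<in> ball 0 1 \<Longrightarrow> \<psi> u \<in> S \<and> \<phi> (\<psi> u) = u"
proof -
  have "S \<noteq> {}" using assms by auto
  with assms Riemann_mapping_theorem[of S] obtain f g
    where f: "f holomorphic_on S" and g: "g holomorphic_on ball 0 1"
      and fg: "\<And>z. z \<in> S \<Longrightarrow> f z \<in> ball 0 1 \<and> g (f z) = z"
      and gf: "\<And>z. z \<in> ball 0 1 \<Longrightarrow> g z \<in> S \<and> f (g z) = z"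
    by metis
  have b: "f 0 \<in> ball 0 1" using fg assms by blast
  obtain h k where hk: "h (f 0) = 0" "h holomorphic_on ball 0 1" "h ` ball 0 1 \<subseteq> ball 0 1"
      "k holomorphic_on ball 0 1" "k ` ball 0 1 \<subseteq> ball 0 1"
      "\<And>z. z \<in> ball 0 1 \<Longrightarrow> h (k z) = z" "\<And>z. z \<in> ball 0 1 \<Longrightarrow> k (h z) = z"
    using ball_biholomorphism_exists[OF b] by metis
  show ?thesis
  proof
    show "h \<circ> f holomorphic_on S"
      using f hk(2) by (rule holomorphic_on_compose_gen) (use fg in auto)
    show "g \<circ> k holomorphic_on ball 0 1"
      using hk(4) g hk(5) by (rule holomorphic_on_compose_gen)
    have "k 0 = f 0" using hk(1,7) b by metis
    then show "(g \<circ> k) 0 = 0" using fg assms(3) by auto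
    show "(h \<circ> f) w \<in> ball 0 1 \<and> (g \<circ> k) ((h \<circ> f) w) = w" if "w \<in> S" for w
      using fg[OF that] hk(3,7) by (simp add: image_subset_iff)
    show "(g \<circ> k) u \<in> S \<and> (h \<circ> f) ((g \<circ> k) u) = u" if "u \<in> ball 0 1" for u
      using that gf hk(5,6) by (simp add: image_subset_iff)
  qed
qed

text \<open>
  The image of the exterior domain together with infinity under the inversion \<open>z \<mapsto> 1 / (z - a)\<close>,
  which turns it into a bounded plane domain when \<open>a\<close> is inside \<open>J\<close>.
\<close>

definition inverted_exterior :: "complex set \<Rightarrow> complex \<Rightarrow> complex set" where
  "inverted_exterior J a = {w. w = 0 \<or> a + 1 / w \<in> outside J}"

lemma open_inverted:
  fixes V :: "complex set" and a :: complex
  assumes "open V" and far: "\<And>z. norm z > B \<Longrightarrow> z \<in> V"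
  shows "open {w. w = 0 \<or> a + 1 / w \<in> V}"
proof -
  define e where "e = 1 / (\<bar>B\<bar> + norm a + 1)"
  have "e > 0" unfolding e_def by (smt (verit) norm_ge_zero zero_less_divide_1_iff)
  have "a + 1 / w \<in> V" if "w \<in> ball 0 e" "w \<noteq> 0" for w
  proof (rule far)
    have "norm w < e" "norm w > 0" using that by auto
    then have "1 / e < 1 / norm w" by (intro divide_strict_left_mono mult_pos_pos \<open>e > 0\<close>) auto
    then have "norm (1 / w) > \<bar>B\<bar> + norm a + 1" by (simp add: e_def norm_divide)
    moreover have "norm (1 / w) \<le> norm (a + 1 / w) + norm a"
      using norm_triangle_ineq4[of "a + 1 / w" a] by simp
    ultimately show "norm (a + 1 / w) > B" by linarith
  qed
  then have "{w. w = 0 \<or> a + 1 / w \<in> V} = ball 0 e \<union> ({w. w \<noteq> 0} \<inter> (\<lambda>w. a + 1 / w) -` V)"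
    using \<open>e > 0\<close> by (auto simp: set_eq_iff)
  moreover have "open ({w::complex. w \<noteq> 0} \<inter> (\<lambda>w. a + 1 / w) -` V)"
    using \<open>open V\<close> by (intro continuous_open_preimage continuous_intros) (auto simp: open_Collect_neq)
  ultimately show ?thesis by auto
qed

lemma outside_far:
  assumes "bounded (inside J)" "bounded J"
  obtains B where "B > 0" "\<And>z. norm z > B \<Longrightarrow> z \<in> outside J"
proof -
  have "bounded (inside J \<union> J)" using assms by simp
  then obtain B where "B > 0" "\<And>z. z \<in> inside J \<union> J \<Longrightarrow> norm z \<le> B"
    by (meson bounded_pos)
  then show ?thesis using that[of B] inside_Un_outside[of J] by fastforce
qed

context
  fixes c :: "real \<Rightarrow> complex" and J :: "complex set"
  assumes c: "simple_path c" "pathfinish c = pathstart c" "path_image c = J"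
begin

lemma Jordan_facts:
  "open (inside J)" "connected (inside J)" "bounded (inside J)"
  "open (outside J)" "connected (outside J)" "\<not> bounded (outside J)"
  "frontier (inside J) = J" "frontier (outside J) = J" "compact J" "J \<noteq> {}" "inside J \<noteq> {}"
  using Jordan_inside_outside[OF c(1,2)] c by (auto simp: compact_simple_path_image)

lemma compact_closed_Jordan_domain: "compact (inside J \<union> J)"
  using Jordan_facts by (metis bounded_closure closure_Un_frontier compact_eq_bounded_closed closed_closure)

lemma open_inverted_exterior: "open (inverted_exterior J a)"
proof -
  obtain B where "\<And>z. norm z > B \<Longrightarrow> z \<in> outside J"
    using outside_far Jordan_facts compact_imp_bounded by metis
  then show ?thesis
    unfolding inverted_exterior_def using open_inverted[OF Jordan_facts(4)] by blast
qed

context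
  fixes a :: complex
  assumes a: "a \<in> inside J"
begin

lemma bounded_inverted_exterior: "bounded (inverted_exterior J a)"
proof -
  obtain e where e: "e > 0" "ball a e \<subseteq> inside J"
    using Jordan_facts(1) a by (meson open_contains_ball)
  have "norm w \<le> 1 / e" if "w \<in> inverted_exterior J a" for w
  proof (cases "w = 0")
    case False
    then have "a + 1 / w \<notin> inside J"
      using that False by (simp add: inverted_exterior_def outside_inside)
    then have "a + 1 / w \<notin> ball a e" using e by blast
    then have "norm (1 / w) \<ge> e" by (simp add: dist_norm)
    then show ?thesis using False e by (simp add: norm_divide field_simps)
  qed (use e in auto)
  then show ?thesis by (meson boundedI)
qed

text \<open>
  The inversion of the exterior is connected, and adding its limit point \<open>0\<close> keeps it so.
\<close>

lemma connected_inverted_exterior: "connected (inverted_exterior J a)"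
proof (rule connected_intermediate_closure)
  let ?f = "\<lambda>z. 1 / (z - a)"
  have na: "a \<notin> outside J" using a inside_Int_outside[of J] by blast
  show "connected (?f ` outside J)"
    using Jordan_facts(5) na by (intro connected_continuous_image continuous_intros) auto
  show "?f ` outside J \<subseteq> inverted_exterior J a"
    by (auto simp: inverted_exterior_def)
  have sub: "inverted_exterior J a - {0} \<subseteq> ?f ` outside J"
  proof
    fix w assume "w \<in> inverted_exterior J a - {0}"
    then show "w \<in> ?f ` outside J"
      by (intro image_eqI[of _ _ "a + 1 / w"]) (auto simp: inverted_exterior_def)
  qed
  have "0 islimpt inverted_exterior J a"
    using open_inverted_exterior by (intro interior_limit_point)
      (auto simp: inverted_exterior_def interior_open)
  then have "0 \<in> closure (inverted_exterior J a - {0})"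
    by (metis islimpt_in_closure)
  then have "0 \<in> closure (?f ` outside J)"
    using closure_mono[OF sub] by blast
  then show "inverted_exterior J a \<subseteq> closure (?f ` outside J)"
    using sub closure_subset[of "?f ` outside J"] by auto
qed

text \<open>
  A bounded plane domain with connected complement is simply connected.  Here the complement is the
  inversion of the closed Jordan domain punctured at \<open>a\<close>; puncturing an open connected set in the
  plane leaves it connected, and the boundary points are added by passing to a set between it and its closure.
\<close>

lemma connected_Compl_inverted_exterior: "connected (- inverted_exterior J a)"
proof -
  let ?I = "inside J \<union> J"
  have "connected (?I - {a})"
  proof (rule connected_intermediate_closure)
    show "connected (inside J - {a})"
      using Jordan_facts(1,2) by (intro connected_open_delete) auto
    have "a islimpt inside J"
      using Jordan_facts(1) a by (intro interior_limit_point) (simp add: interior_open)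
    then have "a \<in> closure (inside J - {a})"
      by (metis islimpt_in_closure)
    then have "closure (inside J - {a}) = closure (inside J)"
      by (metis a closure_insert insert_Diff insert_absorb closure_closure)
    then show "?I - {a} \<subseteq> closure (inside J - {a})"
      using Jordan_facts(7) by (auto simp: closure_Un_frontier)
  qed auto
  then have "connected ((\<lambda>z. 1 / (z - a)) ` (?I - {a}))"
    by (intro connected_continuous_image continuous_intros) auto
  moreover have "(\<lambda>z. 1 / (z - a)) ` (?I - {a}) = - inverted_exterior J a"
  proof (intro equalityI subsetI)
    fix w assume w: "w \<in> - inverted_exterior J a"
    then have "w \<noteq> 0" "a + 1 / w \<notin> outside J" by (auto simp: inverted_exterior_def)
    then have "w \<noteq> 0" "a + 1 / w \<in> ?I - {a}" by (auto simp: outside_inside)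
    then show "w \<in> (\<lambda>z. 1 / (z - a)) ` (?I - {a})"
      by (intro image_eqI[of _ _ "a + 1 / w"]) auto
  qed (use inside_Int_outside[of J] outside_no_overlap[of J] in \<open>auto simp: inverted_exterior_def outside_inside\<close>)
  ultimately show ?thesis by simp
qed

text \<open>
  The last clause says that a closed set \<open>G\<close> in the exterior stays away from the unit circle in
  the coordinate of the Riemann map: adding infinity to \<open>G\<close> gives a compact subset of the domain.
\<close>

lemma exterior_Riemann_map:
  obtains \<psi> where "\<psi> holomorphic_on ball 0 1" "inj_on \<psi> (ball 0 1)" "\<psi> 0 = 0"
    and "\<And>u. u \<in> ball 0 1 - {0} \<Longrightarrow> a + 1 / \<psi> u \<in> outside J"
    and "\<And>G. closed G \<Longrightarrow> G \<subseteq> outside J \<Longrightarrow>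
           \<exists>s. 0 < s \<and> s < 1 \<and> (\<forall>z\<in>G. \<exists>v. v \<noteq> 0 \<and> norm v \<le> s \<and> 1 / \<psi> v = z - a)"
proof -
  let ?\<Omega> = "inverted_exterior J a"
  have "simply_connected ?\<Omega>"
    using simply_connected_iff_simple[OF open_inverted_exterior bounded_inverted_exterior]
      connected_inverted_exterior connected_Compl_inverted_exterior by blast
  moreover have "?\<Omega> \<noteq> UNIV" using bounded_inverted_exterior by auto
  moreover have "0 \<in> ?\<Omega>" by (simp add: inverted_exterior_def)
  ultimately obtain \<phi> \<psi> where \<phi>: "\<phi> holomorphic_on ?\<Omega>" and \<psi>: "\<psi> holomorphic_on ball 0 1" "\<psi> 0 = 0"
    and \<psi>\<phi>: "\<And>w. w \<in> ?\<Omega> \<Longrightarrow> \<phi> w \<in> ball 0 1 \<and> \<psi> (\<phi> w) = w"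
    and \<phi>\<psi>: "\<And>u. u \<in> ball 0 1 \<Longrightarrow> \<psi> u \<in> ?\<Omega> \<and> \<phi> (\<psi> u) = u"
    using Riemann_mapping_normalized[OF open_inverted_exterior] by metis
  show ?thesis
  proof
    show "\<psi> holomorphic_on ball 0 1" "\<psi> 0 = 0" by (fact \<psi>)+
    show "inj_on \<psi> (ball 0 1)" using \<phi>\<psi> by (metis inj_onI)
    show "a + 1 / \<psi> u \<in> outside J" if "u \<in> ball 0 1 - {0}" for u
    proof -
      have "\<psi> u \<noteq> 0" using \<phi>\<psi>[of u] \<phi>\<psi>[of 0] that \<psi>(2) by auto
      then show ?thesis using \<phi>\<psi>[of u] that by (auto simp: inverted_exterior_def)
    qed
    fix G assume G: "closed G" "G \<subseteq> outside J"
    \<comment> \<open>The point \<open>0\<close> (infinity, before inversion) makes \<open>K\<close> closed even when \<open>G\<close> is unbounded.\<close>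
    define K where "K = {w. w = 0 \<or> a + 1 / w \<in> G}"
    have KO: "K \<subseteq> ?\<Omega>" using G by (auto simp: K_def inverted_exterior_def)
    have "- K = {w. w \<noteq> 0} \<inter> (\<lambda>w. a + 1 / w) -` (- G)" by (auto simp: K_def)
    also have "open \<dots>"
      using G by (intro continuous_open_preimage continuous_intros) (auto simp: open_Collect_neq)
    finally have "closed K" by (simp add: closed_def)
    then have "compact K"
      using KO bounded_inverted_exterior bounded_subset compact_eq_bounded_closed by blast
    then have "compact (\<phi> ` K)"
      using \<phi> KO holomorphic_on_imp_continuous_on holomorphic_on_subset
      by (intro compact_continuous_image) blast+
    moreover have "\<phi> ` K \<noteq> {}" by (auto simp: K_def)
    ultimately obtain y where y: "y \<in> \<phi> ` K" "\<And>z. z \<in> \<phi> ` K \<Longrightarrow> norm z \<le> norm y"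
      using continuous_attains_sup[of "\<phi> ` K" norm] by (auto intro: continuous_intros)
    define s where "s = max (1/2) (norm y)"
    have "norm y < 1" using y(1) KO \<psi>\<phi> by (auto simp: subset_iff)
    have "\<exists>v. v \<noteq> 0 \<and> norm v \<le> s \<and> 1 / \<psi> v = z - a" if "z \<in> G" for z
    proof -
      let ?w = "1 / (z - a)"
      have "z \<noteq> a" using that G a inside_Int_outside[of J] by blast
      then have w: "?w \<in> K" "?w \<noteq> 0" using that by (auto simp: K_def)
      then have "norm (\<phi> ?w) \<le> norm y" using y(2) by blast
      then have "norm (\<phi> ?w) \<le> s" by (simp add: s_def)
      moreover have *: "\<psi> (\<phi> ?w) = ?w" using \<psi>\<phi> w KO by blast
      moreover from * have "\<phi> ?w \<noteq> 0" using w(2) \<psi>(2) by metis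
      ultimately show ?thesis by (intro exI[of _ "\<phi> ?w"]) simp
    qed
    then show "\<exists>s. 0 < s \<and> s < 1 \<and> (\<forall>z\<in>G. \<exists>v. v \<noteq> 0 \<and> norm v \<le> s \<and> 1 / \<psi> v = z - a)"
      using \<open>norm y < 1\<close> by (intro exI[of _ s]) (auto simp: s_def)
  qed
qed

end

section \<open>Separating a closed Jordan domain from its exterior\<close>

text \<open>
  Let \<open>F\<^sub>m\<close> be the Faber polynomial of index \<open>m\<close> in the variable \<open>z - a\<close>.  Choose \<open>s < t < r < 1\<close> such
  that \<open>G\<close> corresponds to parameters \<open>v\<close> of modulus at most \<open>s\<close>.  On the closed Jordan domain
  \<open>F\<^sub>m = O(r ^ (- m))\<close>, while on \<open>G\<close> it equals \<open>1 / v ^ (m + 1) + O(r ^ (- m))\<close>, both uniformly by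
  compactness.  Multiplied by \<open>t ^ (m + 1)\<close>, the first bound tends to zero and the modulus on \<open>G\<close>
  is at least \<open>(t / s) ^ (m + 1) - 1\<close> for large \<open>m\<close>.
\<close>

lemma separating_polynomial:
  assumes G: "closed G" "G \<subseteq> outside J" and "e > 0"
  obtains \<omega> :: "complex poly"
  where "\<And>z. z \<in> inside J \<union> J \<Longrightarrow> norm (poly \<omega> z) \<le> e"
    and "\<And>z. z \<in> G \<Longrightarrow> norm (poly \<omega> z) \<ge> 1 / e"
proof -
  obtain a where a: "a \<in> inside J" using Jordan_facts by blast
  obtain \<psi> where holo: "\<psi> holomorphic_on ball 0 1" and inj: "inj_on \<psi> (ball 0 1)" and zero: "\<psi> 0 = 0"
    and out: "\<And>u. u \<in> ball 0 1 - {0} \<Longrightarrow> a + 1 / \<psi> u \<in> outside J"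
    and ex: "\<And>G. closed G \<Longrightarrow> G \<subseteq> outside J \<Longrightarrow>
           \<exists>s. 0 < s \<and> s < 1 \<and> (\<forall>z\<in>G. \<exists>v. v \<noteq> 0 \<and> norm v \<le> s \<and> 1 / \<psi> v = z - a)"
    using exterior_Riemann_map[OF a] by blast
  obtain s where s: "0 < s" "s < 1"
    and Gs: "\<And>z. z \<in> G \<Longrightarrow> \<exists>v. v \<noteq> 0 \<and> norm v \<le> s \<and> 1 / \<psi> v = z - a"
    using ex[OF G] by blast
  define r where "r = (s + 2) / 3"
  define t where "t = (2 * s + 1) / 3"
  have rt: "s < t" "t < r" "r < 1" "0 < t" "0 < r" using s by (auto simp: r_def t_def)
  have contd: "continuous_on (ball 0 1) \<psi>" "continuous_on (ball 0 1) (deriv \<psi>)"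
    using holo by (auto intro: holomorphic_on_imp_continuous_on holomorphic_deriv)
  have rsub: "sphere 0 r \<subseteq> (ball 0 1 :: complex set)" and ssub: "cball 0 s \<subseteq> (ball 0 1 :: complex set)"
    using rt s by auto
  have ne: "(z - a) * \<psi> u \<noteq> 1" if "z \<in> inside J \<union> J" "u \<in> ball 0 1" for z u
  proof
    assume eq: "(z - a) * \<psi> u = 1"
    then have "u \<noteq> 0" "\<psi> u \<noteq> 0" using zero by auto
    then have "a + 1 / \<psi> u = z" using eq by (simp add: field_simps)
    then have "z \<in> outside J" using out[of u] that \<open>u \<noteq> 0\<close> by auto
    then show False using that by (simp add: outside_inside)
  qed
  have "compact ((inside J \<union> J) \<times> sphere (0::complex) r)"
    by (intro compact_Times compact_closed_Jordan_domain) auto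
  moreover have "continuous_on ((inside J \<union> J) \<times> sphere 0 r)
      (\<lambda>(z, u). (z - a) * deriv \<psi> u / (1 - (z - a) * \<psi> u))"
    unfolding case_prod_unfold using rsub ne
    by (intro continuous_intros continuous_on_compose2[OF contd(1)] continuous_on_compose2[OF contd(2)])
      (fastforce simp: mem_Times_iff)+
  ultimately have "bounded ((\<lambda>(z, u). (z - a) * deriv \<psi> u / (1 - (z - a) * \<psi> u)) `
      ((inside J \<union> J) \<times> sphere 0 r))"
    by (intro compact_imp_bounded compact_continuous_image)
  then obtain B1 where B1: "\<And>z u. z \<in> inside J \<union> J \<Longrightarrow> norm u = r \<Longrightarrow>
      norm ((z - a) * deriv \<psi> u / (1 - (z - a) * \<psi> u)) \<le> B1"
    unfolding bounded_iff by fastforce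
  have ne2: "\<psi> v \<noteq> \<psi> u" "v \<noteq> u" if "v \<in> cball 0 s" "u \<in> sphere 0 r" for u v
  proof -
    show "v \<noteq> u" using that rt by auto
    then show "\<psi> v \<noteq> \<psi> u" using that inj rsub ssub by (metis inj_on_eq_iff subsetD)
  qed
  have "compact (cball (0::complex) s \<times> sphere (0::complex) r)"
    by (intro compact_Times) auto
  moreover have "continuous_on (cball 0 s \<times> sphere 0 r)
      (\<lambda>(v, u). deriv \<psi> u / (\<psi> v - \<psi> u) - 1 / (v - u))"
    unfolding case_prod_unfold using rsub ssub ne2
    by (intro continuous_intros continuous_on_compose2[OF contd(1)] continuous_on_compose2[OF contd(2)])
      (fastforce simp: mem_Times_iff)+
  ultimately have "bounded ((\<lambda>(v, u). deriv \<psi> u / (\<psi> v - \<psi> u) - 1 / (v - u)) `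
      (cball 0 s \<times> sphere 0 r))"
    by (intro compact_imp_bounded compact_continuous_image)
  then obtain B2 where B2: "\<And>v u. norm v \<le> s \<Longrightarrow> norm u = r \<Longrightarrow>
      norm (deriv \<psi> u / (\<psi> v - \<psi> u) - 1 / (v - u)) \<le> B2"
    unfolding bounded_iff by fastforce
  have "((\<lambda>m. t * B1 * (t / r) ^ m) \<longlonglongrightarrow> t * B1 * 0)"
    using rt by (intro tendsto_mult_left LIMSEQ_realpow_zero) auto
  then have ev1: "eventually (\<lambda>m. t * B1 * (t / r) ^ m < e) sequentially"
    using \<open>e > 0\<close> by (auto dest: order_tendstoD)
  have "((\<lambda>m. t * B2 * (t / r) ^ m) \<longlonglongrightarrow> t * B2 * 0)"
    using rt by (intro tendsto_mult_left LIMSEQ_realpow_zero) auto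
  from order_tendstoD(2)[OF this, of 1]
  have ev2: "eventually (\<lambda>m. t * B2 * (t / r) ^ m < 1) sequentially" by simp
  have "filterlim (\<lambda>m. norm ((t / s) ^ Suc m)) at_top sequentially"
    using rt s by (subst filterlim_sequentially_Suc)
      (intro filterlim_at_infinity_imp_norm_at_top filterlim_realpow_sequentially_gt1, auto)
  then have "filterlim (\<lambda>m. (t / s) ^ Suc m) at_top sequentially"
    using rt s by (simp add: norm_power del: power_Suc)
  then have ev3: "eventually (\<lambda>m. (t / s) ^ Suc m \<ge> 1 / e + 1) sequentially"
    by (auto simp: filterlim_at_top)
  obtain m where m: "t * B1 * (t / r) ^ m < e" "t * B2 * (t / r) ^ m < 1" "(t / s) ^ Suc m \<ge> 1 / e + 1"
    using eventually_happens[OF eventually_conj[OF ev1 eventually_conj[OF ev2 ev3]]] by auto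
  define \<omega> where "\<omega> = smult (of_real (t ^ Suc m)) (pcompose (faber_poly \<psi> m) [:- a, 1:])"
  have \<omega>: "poly \<omega> z = of_real (t ^ Suc m) * poly (faber_poly \<psi> m) (z - a)" for z
    by (simp add: \<omega>_def poly_pcompose del: power_Suc)
  have tr: "t ^ Suc m * (B / r ^ m) = t * B * (t / r) ^ m" for B
    by (simp add: power_divide)
  show ?thesis
  proof
    fix z assume z: "z \<in> inside J \<union> J"
    have "norm (poly (faber_poly \<psi> m) (z - a)) \<le> B1 / r ^ m"
      using norm_faber_poly_inner[OF holo zero \<open>0 < r\<close> \<open>r < 1\<close>] ne[OF z] B1[OF z] by blast
    then have "norm (poly \<omega> z) \<le> t ^ Suc m * (B1 / r ^ m)"
      using rt by (simp only: \<omega> norm_mult norm_of_real) (intro mult_mono, auto)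
    then show "norm (poly \<omega> z) \<le> e" using m(1) unfolding tr by linarith
  next
    fix z assume "z \<in> G"
    then obtain v where v: "v \<noteq> 0" "norm v \<le> s" "1 / \<psi> v = z - a" using Gs by blast
    have "norm (poly (faber_poly \<psi> m) (1 / \<psi> v) - 1 / v ^ Suc m) \<le> B2 / r ^ m"
      using v rt B2 by (intro norm_faber_poly_outer[OF holo zero inj]) auto
    then have "norm (1 / v ^ Suc m) \<le> norm (poly (faber_poly \<psi> m) (z - a)) + B2 / r ^ m"
      using v(3) norm_triangle_ineq3[of "poly (faber_poly \<psi> m) (1 / \<psi> v)" "1 / v ^ Suc m"]
      by (simp add: abs_le_iff del: power_Suc)
    then have "t ^ Suc m * norm (1 / v ^ Suc m)
        \<le> t ^ Suc m * (norm (poly (faber_poly \<psi> m) (z - a)) + B2 / r ^ m)"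
      using rt by (intro mult_left_mono) auto
    also have "\<dots> = norm (poly \<omega> z) + t * B2 * (t / r) ^ m"
      using rt tr[of B2] by (simp add: \<omega> norm_mult norm_power distrib_left del: power_Suc)
    finally have "t ^ Suc m * norm (1 / v ^ Suc m) \<le> norm (poly \<omega> z) + 1"
      using m(2) by linarith
    moreover have "(t / s) ^ Suc m \<le> (t / norm v) ^ Suc m"
      using v s rt by (intro power_mono divide_left_mono) (auto intro: mult_pos_pos)
    moreover have "t ^ Suc m * norm (1 / v ^ Suc m) = (t / norm v) ^ Suc m"
      by (simp add: norm_divide norm_power power_divide del: power_Suc)
    ultimately show "norm (poly \<omega> z) \<ge> 1 / e" using m(3) by linarith
  qed
qed

end


section \<open>Hausdorff distance and the topology of the sphere\<close>

lemma hausdorff_dist_le: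
  assumes "e > 0" "X \<subseteq> closed_nbhd e Y" "Y \<subseteq> closed_nbhd e X"
  shows "hausdorff_dist X Y \<le> ereal e"
  unfolding hausdorff_dist_def by (rule INF_lower) (use assms in simp)

lemma hausdorff_dist_infinity_le:
  assumes "ball_at_infinity r \<subseteq> X \<inter> Y"
    and le: "\<forall>\<^sub>F R in at_top. hausdorff_dist (finite_part (X - ball_at_infinity R))
                                (finite_part (Y - ball_at_infinity R)) \<le> e"
  shows "hausdorff_dist_infinity X Y \<le> e"
proof -
  have "\<forall>\<^sub>F R in at_top. ball_at_infinity R \<subseteq> X \<inter> Y \<and>
      hausdorff_dist (finite_part (X - ball_at_infinity R))
        (finite_part (Y - ball_at_infinity R)) = hausdorff_dist_infinity X Y"
    unfolding hausdorff_dist_infinity_def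
    by (rule theI'[OF hausdorff_dist_infinity_well_defined[OF assms(1)]])
  with le have "\<forall>\<^sub>F R::real in at_top. hausdorff_dist_infinity X Y \<le> e"
    by eventually_elim auto
  then show ?thesis by simp
qed

text \<open>
  A connected set cannot meet both of two disjoint open pieces that cover the space, so a component
  that meets a connected piece coincides with it.
\<close>

lemma connected_component_eq_clopen_part:
  assumes U: "openin X U" "connectedin X U" and V: "openin X V"
    and UV: "U \<inter> V = {}" "topspace X = U \<union> V"
    and C: "C \<in> connected_components_of X" "C \<inter> U \<noteq> {}"
  shows "C = U"
proof
  show "U \<subseteq> C"
    using connected_components_of_maximal[OF C(1) U(2)] C(2) by (auto simp: disjnt_def)
  have "connectedin X C" using C(1) by (rule connectedin_connected_components_of)
  then have "C \<subseteq> U \<union> V"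
    and no_split: "\<not> (\<exists>E1 E2. openin X E1 \<and> openin X E2 \<and> C \<subseteq> E1 \<union> E2 \<and>
      E1 \<inter> E2 \<inter> C = {} \<and> E1 \<inter> C \<noteq> {} \<and> E2 \<inter> C \<noteq> {})"
    using UV(2) by (simp_all add: connectedin)
  moreover have "V \<inter> C = {}"
  proof (rule ccontr)
    assume "V \<inter> C \<noteq> {}"
    moreover have "U \<inter> V \<inter> C = {}" "U \<inter> C \<noteq> {}"
      using UV(1) C(2) by (simp_all add: Int_commute)
    ultimately show False
      using no_split U(1) V \<open>C \<subseteq> U \<union> V\<close> by metis
  qed
  ultimately show "C \<subseteq> U" by blast
qed

lemma in_closure_of_sphere:
  "Some z \<in> sphere_top closure_of S \<longleftrightarrow> z \<in> closure (finite_part S)"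
proof
  assume z: "Some z \<in> sphere_top closure_of S"
  show "z \<in> closure (finite_part S)"
    unfolding closure_iff_nhds_not_empty
  proof (intro allI impI)
    fix A T assume "T \<subseteq> A" "open T" "z \<in> T"
    then have "openin sphere_top (Some ` T)" "Some z \<in> Some ` T" by auto
    then obtain y where "y \<in> S" "y \<in> Some ` T" using z by (meson in_closure_of)
    then show "finite_part S \<inter> A \<noteq> {}" using \<open>T \<subseteq> A\<close> by (auto simp: finite_part_def)
  qed
next
  assume z: "z \<in> closure (finite_part S)"
  show "Some z \<in> sphere_top closure_of S"
    unfolding in_closure_of
  proof (intro conjI allI impI)
    fix T assume T: "Some z \<in> T \<and> openin sphere_top T"
    have "open {x. Some x \<in> T}"
      using openin_continuous_map_preimage[OF continuous_map_Some, of euclidean T] T by simp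
    moreover have "z \<in> {x. Some x \<in> T}" using T by simp
    ultimately have "finite_part S \<inter> {x. Some x \<in> T} \<noteq> {}"
      using z unfolding closure_iff_nhds_not_empty by blast
    then show "\<exists>y. y \<in> S \<and> y \<in> T" by (auto simp: finite_part_def)
  qed auto
qed

lemma finite_part_frontier_of:
  "finite_part (sphere_top frontier_of S) = frontier (finite_part S)"
proof -
  have "topspace sphere_top = (UNIV :: riemann_sphere set)" by (auto simp: notin_range_Some)
  then have "finite_part (sphere_top frontier_of S) =
      closure (finite_part S) \<inter> closure (finite_part (- S))"
    unfolding frontier_of_closures finite_part_def[of "_ closure_of _ \<inter> _"]
    by (simp add: in_closure_of_sphere Compl_eq_Diff_UNIV Collect_conj_eq)
  moreover have "finite_part (- S) = - finite_part S" by (auto simp: finite_part_def)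
  ultimately show ?thesis by (simp add: frontier_closures)
qed

section \<open>Polynomial dynamics near infinity\<close>

lemma open_cobounded_sphere: "openin sphere_top (insert None (Some ` (- cball 0 B)))"
  unfolding openin_Alexandroff_compactification
  by (rule disjI2, rule exI[of _ "cball 0 B"]) (auto simp: Compl_eq_Diff_UNIV)

lemma funpow_poly_map: "(poly_map p ^^ n) (Some z) = Some ((poly p ^^ n) z)"
  by (induction n) auto

lemma funpow_poly_map_None: "degree p \<noteq> 0 \<Longrightarrow> (poly_map p ^^ n) None = None"
  by (induction n) auto

lemma None_in_basin_infinity: "degree p \<noteq> 0 \<Longrightarrow> None \<in> basin_infinity (poly_map p)"
  by (simp add: basin_infinity_def funpow_poly_map_None limitin_const_iff limitin_def)

lemma basin_infinityI:
  assumes "filterlim (\<lambda>n. (poly p ^^ n) z) at_infinity sequentially"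
  shows "Some z \<in> basin_infinity (poly_map p)"
  unfolding basin_infinity_def mem_Collect_eq limitin_def
proof (intro conjI allI impI)
  fix U assume U: "openin sphere_top U \<and> None \<in> U"
  then obtain C where C: "compact C" "U = insert None (Some ` (- C))"
    by (auto simp: openin_Alexandroff_compactification Compl_eq_Diff_UNIV)
  then obtain B where "\<And>x. x \<in> C \<Longrightarrow> norm x \<le> B"
    using compact_imp_bounded by (meson bounded_iff)
  moreover have "\<forall>\<^sub>F n in sequentially. B + 1 \<le> norm ((poly p ^^ n) z)"
    using assms unfolding filterlim_at_infinity[OF order_refl]
    by (metis filterlim_at_infinity_imp_norm_at_top assms filterlim_at_top)
  ultimately show "\<forall>\<^sub>F n in sequentially. (poly_map p ^^ n) (Some z) \<in> U"
    by (auto simp: C funpow_poly_map elim!: eventually_mono) fastforce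
qed auto

lemma not_in_basin_infinityI:
  assumes "bounded C" "z \<in> C" and inv: "\<And>w. w \<in> C \<Longrightarrow> poly p w \<in> C"
  shows "Some z \<notin> basin_infinity (poly_map p)"
proof
  assume "Some z \<in> basin_infinity (poly_map p)"
  obtain B where B: "\<And>x. x \<in> C \<Longrightarrow> norm x \<le> B"
    using \<open>bounded C\<close> by (meson bounded_iff)
  have C: "(poly p ^^ n) z \<in> C" for n
    by (induction n) (use assms in auto)
  have "\<forall>\<^sub>F n in sequentially. (poly_map p ^^ n) (Some z) \<in> insert None (Some ` (- cball 0 B))"
    using \<open>Some z \<in> _\<close> open_cobounded_sphere[of B]
    by (auto simp: basin_infinity_def limitin_def)
  then have "\<forall>\<^sub>F n::nat in sequentially. False"
    by eventually_elim (use B C in \<open>fastforce simp: funpow_poly_map\<close>)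
  then show False by simp
qed

text \<open>
  With \<open>p(z) = c + z q(z)\<close> the chart map divided by \<open>w\<close> is \<open>1 / (c w + q(1 / w))\<close>, which tends to
  zero because \<open>q\<close> is not constant: infinity is superattracting.
\<close>

lemma infinity_attracting_poly_map:
  assumes "degree p \<ge> 2"
  shows "infinity_attracting (poly_map p)"
proof -
  obtain c q where p: "p = pCons c q" by (cases p)
  with assms have "degree q > 0" by (auto split: if_splits)
  define f where "f = at_infinity_chart (poly_map p)"
  have f0: "f 0 = 0" using assms by (simp add: f_def at_infinity_chart_def)
  have fw: "f w = inverse (poly p (inverse w))" if "w \<noteq> 0" for w
    using that by (simp add: f_def at_infinity_chart_def)
  have inv: "filterlim (\<lambda>w::complex. inverse w) at_infinity (at 0)"
    by (rule filterlim_inverse_at_infinity)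
  have "filterlim (\<lambda>w. poly q (inverse w)) at_infinity (at 0)"
    by (rule filterlim_compose[OF filterlim_poly_at_infinity[OF \<open>degree q > 0\<close>] inv])
  moreover have "((\<lambda>w. c * w) \<longlongrightarrow> c * 0) (at 0)" by (intro tendsto_intros)
  ultimately have "filterlim (\<lambda>w. c * w + poly q (inverse w)) at_infinity (at 0)"
    by (intro tendsto_add_filterlim_at_infinity)
  then have "((\<lambda>w. inverse (c * w + poly q (inverse w))) \<longlongrightarrow> 0) (at 0)"
    by (rule filterlim_compose[OF tendsto_inverse_0])
  moreover have "\<forall>\<^sub>F w in at 0. inverse (c * w + poly q (inverse w)) = (f w - f 0) / (w - 0)"
    using eventually_neq_at_within[of 0]
  proof eventually_elim
    case (elim w)
    then have "w * poly p (inverse w) = c * w + poly q (inverse w)"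
      by (simp add: p algebra_simps)
    then show ?case using elim
      by (simp add: f0 fw field_simps)
  qed
  ultimately have "((\<lambda>w. (f w - f 0) / (w - 0)) \<longlongrightarrow> 0) (at 0)"
    by (rule Lim_transform_eventually)
  then have "(f has_field_derivative 0) (at 0)"
    by (simp add: has_field_derivative_iff)
  then show ?thesis
    using assms by (auto simp: infinity_attracting_def f_def intro!: exI[of _ 0])
qed


text \<open>
  Take \<open>p(z) = a + (z - a) \<omega>(z)\<close> with \<open>a\<close> inside \<open>J\<close> and \<open>\<omega>\<close> tiny on the closed Jordan domain and huge
  on \<open>G\<close>.  Then \<open>p\<close> maps the closed Jordan domain into a small disc about \<open>a\<close>, hence into itself.  On
  \<open>G\<close> it moves points so far from \<open>a\<close> that they return to \<open>G\<close>, at least doubling the distance to \<open>a\<close>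
  in every step, so that their orbits tend to infinity.
\<close>

lemma polynomial_with_prescribed_basin:
  fixes c :: "real \<Rightarrow> complex"
  assumes c: "simple_path c" "pathfinish c = pathstart c" "path_image c = J"
    and G: "closed G" "G \<subseteq> outside J" and far: "\<And>z. norm z > B \<Longrightarrow> z \<in> G"
  obtains p :: "complex poly" where "degree p \<ge> 2"
    and "\<And>z. z \<in> inside J \<union> J \<Longrightarrow> Some z \<notin> basin_infinity (poly_map p)"
    and "\<And>z. z \<in> G \<Longrightarrow> Some z \<in> basin_infinity (poly_map p)"
proof -
  obtain a where a: "a \<in> inside J" using Jordan_facts[OF c] by blast
  note facts = Jordan_facts[OF c]
  obtain \<rho> where \<rho>: "\<rho> > 0" "cball a \<rho> \<subseteq> inside J"
    using facts(1) a by (meson open_contains_cball)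
  define M where "M = \<bar>B\<bar> + norm a + 1"
  have "M > 0" unfolding M_def by (smt (verit) norm_ge_zero)
  have inG: "z \<in> G" if "norm (z - a) \<ge> M" for z
    using that norm_triangle_ineq4[of z a] by (intro far) (simp add: M_def)
  have "bounded (inside J \<union> J)" by (rule compact_imp_bounded[OF compact_closed_Jordan_domain[OF c]])
  then obtain b where "b > 0" "\<And>z. z \<in> inside J \<union> J \<Longrightarrow> norm z \<le> b"
    unfolding bounded_pos by auto
  then have "\<exists>D > 0. \<forall>z \<in> inside J \<union> J. norm (z - a) \<le> D"
    by (intro exI[of _ "b + norm a"] conjI ballI norm_triangle_le_diff add_pos_nonneg) auto
  then obtain D where D: "D > 0" "\<And>z. z \<in> inside J \<union> J \<Longrightarrow> norm (z - a) \<le> D"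
    by blast
  \<comment> \<open>\<open>\<rho> / D\<close> makes the domain invariant, \<open>\<rho> / M\<close> sends \<open>G\<close> into itself, \<open>1 / 2\<close> gives the doubling.\<close>
  define e where "e = min (1 / 2) (min (\<rho> / D) (\<rho> / M))"
  have e: "e > 0" "e \<le> 1 / 2" "e * D \<le> \<rho>" "M \<le> \<rho> / e"
    using \<rho> \<open>M > 0\<close> D by (auto simp: e_def min_def field_simps)
  have "1 / e \<ge> 2" using e by (simp add: field_simps)
  obtain \<omega> :: "complex poly" where \<omega>: "\<And>z. z \<in> inside J \<union> J \<Longrightarrow> norm (poly \<omega> z) \<le> e"
      "\<And>z. z \<in> G \<Longrightarrow> norm (poly \<omega> z) \<ge> 1 / e"
    using separating_polynomial[OF c G \<open>e > 0\<close>] by metis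
  define p where "p = [:a:] + [:- a, 1:] * \<omega>"
  have p: "poly p z - a = (z - a) * poly \<omega> z" for z
    by (simp add: p_def algebra_simps)
  have "a + of_real M \<in> G" using \<open>M > 0\<close> by (intro inG) simp
  have "degree \<omega> \<noteq> 0"
  proof
    assume "degree \<omega> = 0"
    then obtain k where "\<omega> = [:k:]" by (rule degree_eq_zeroE)
    then show False using \<omega>(1)[of a] \<omega>(2)[OF \<open>a + of_real M \<in> G\<close>] a e \<open>1 / e \<ge> 2\<close> by simp
  qed
  then have "\<omega> \<noteq> 0" by auto
  then have "degree ([:- a, 1:] * \<omega>) = Suc (degree \<omega>)"
    by (subst degree_mult_eq) auto
  then have "degree p = Suc (degree \<omega>)"
    unfolding p_def using degree_add_eq_right[of "[:a:]" "[:- a, 1:] * \<omega>"] by simp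
  show ?thesis
  proof
    show "degree p \<ge> 2" using \<open>degree p = _\<close> \<open>degree \<omega> \<noteq> 0\<close> by simp
    fix z assume z: "z \<in> inside J \<union> J"
    show "Some z \<notin> basin_infinity (poly_map p)"
    proof (rule not_in_basin_infinityI)
      fix w assume w: "w \<in> inside J \<union> J"
      have "norm (poly p w - a) \<le> D * e"
        unfolding p norm_mult using \<omega>(1)[OF w] D(2)[OF w] D(1) by (intro mult_mono) auto
      then have "poly p w \<in> cball a \<rho>"
        using e(3) by (simp add: dist_norm norm_minus_commute mult.commute)
      then show "poly p w \<in> inside J \<union> J" using \<rho> by blast
    qed fact+
  next
    fix z assume z: "z \<in> G"
    have "(poly p ^^ n) z \<in> G \<and> norm ((poly p ^^ n) z - a) \<ge> 2 ^ n * \<rho>" for n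
    proof (induction n)
      case 0
      have "z \<notin> cball a \<rho>" using z G(2) \<rho> inside_Int_outside[of J] by blast
      then show ?case using z by (simp add: dist_norm norm_minus_commute)
    next
      case (Suc n)
      let ?w = "(poly p ^^ n) z"
      have step: "norm (poly p ?w - a) \<ge> norm (?w - a) * (1 / e)"
        unfolding p norm_mult using \<omega>(2) Suc by (intro mult_left_mono) auto
      have "2 ^ n * \<rho> * 2 \<le> norm (?w - a) * (1 / e)"
        using Suc \<open>1 / e \<ge> 2\<close> \<rho> by (intro mult_mono) auto
      with step have grow: "norm (poly p ?w - a) \<ge> 2 ^ Suc n * \<rho>" by simp
      have "\<rho> * 1 \<le> \<rho> * 2 ^ n" using \<rho> by (intro mult_left_mono) auto
      then have "\<rho> \<le> norm (?w - a)" using Suc by (simp add: mult.commute)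
      then have "\<rho> * (1 / e) \<le> norm (?w - a) * (1 / e)" using e by (intro mult_right_mono) auto
      then have "poly p ?w \<in> G" using step e(4) by (intro inG) simp
      with grow show ?case by simp
    qed
    then have bound: "2 ^ n * \<rho> - norm a \<le> norm ((poly p ^^ n) z)" for n
      using norm_triangle_ineq4[of "(poly p ^^ n) z" a] by (smt (verit))
    have "filterlim (\<lambda>n. 2 ^ n * \<rho> - norm a) at_top sequentially"
      using \<rho>(1) by real_asymp
    then have "filterlim (\<lambda>n. norm ((poly p ^^ n) z)) at_top sequentially"
      by (rule filterlim_at_top_mono) (simp add: bound)
    then show "Some z \<in> basin_infinity (poly_map p)"
      by (intro basin_infinityI filterlim_norm_at_top_imp_at_infinity)
  qed
qed

section \<open>The two components of the complement of a Jordan curve in the sphere\<close>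

lemma Jordan_sphere_components:
  fixes c :: "real \<Rightarrow> complex"
  assumes c: "simple_path c" "pathfinish c = pathstart c" "path_image c = J"
    and C: "C \<in> sphere_complement_components J"
  shows "C = (if None \<in> C then insert None (Some ` outside J) else Some ` inside J)"
proof -
  note facts = Jordan_facts[OF c]
  let ?X = "subtopology sphere_top (UNIV - Some ` J)"
  let ?U = "Some ` inside J" and ?V = "insert None (Some ` outside J)"
  have UNIV: "topspace sphere_top = (UNIV :: riemann_sphere set)" by (auto simp: notin_range_Some)
  have cover: "topspace ?X = ?U \<union> ?V" "?U \<subseteq> UNIV - Some ` J" "?V \<subseteq> UNIV - Some ` J"
    using UNIV by (auto simp: outside_inside inside_no_overlap dest: not_None_eq[THEN iffD1])
      (auto simp: inside_def)
  have disj: "?U \<inter> ?V = {}" by (auto simp: outside_inside)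
  have openU: "openin sphere_top ?U" using facts(1) by simp
  have "?V = insert None (Some ` (topspace euclidean - (inside J \<union> J)))"
    by (auto simp: outside_inside)
  moreover have "compact (inside J \<union> J)" by (rule compact_closed_Jordan_domain[OF c])
  ultimately have openV: "openin sphere_top ?V"
    unfolding openin_Alexandroff_compactification
    by (intro disjI2 exI[of _ "inside J \<union> J"]) (auto intro: compact_imp_closed)
  have conn: "connectedin sphere_top (Some ` S)" if "connected S" for S
    using connectedin_continuous_map_image[OF continuous_map_Some, of euclidean S] that by simp
  have "None \<in> sphere_top closure_of (Some ` outside J)"
    unfolding in_closure_of
  proof (intro conjI allI impI)
    fix T assume "None \<in> T \<and> openin sphere_top T"
    then obtain K where K: "compact K" "T = insert None (Some ` (- K))"
      by (auto simp: openin_Alexandroff_compactification Compl_eq_Diff_UNIV)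
    then have "\<not> outside J \<subseteq> K" using facts(6) bounded_subset compact_imp_bounded by blast
    then show "\<exists>y. y \<in> Some ` outside J \<and> y \<in> T" using K by auto
  qed auto
  then have connV: "connectedin sphere_top ?V"
    using closure_of_subset[of "Some ` outside J" sphere_top] UNIV
    by (intro connectedin_intermediate_closure_of[OF conn[OF facts(5)]]) auto
  have open_sub: "openin ?X W" if "openin sphere_top W" "W \<subseteq> UNIV - Some ` J" for W
    unfolding openin_subtopology using that by (intro exI[of _ W]) (simp add: inf.absorb1)
  have sub: "openin ?X ?U" "openin ?X ?V" "connectedin ?X ?U" "connectedin ?X ?V"
    using open_sub[OF openU cover(2)] open_sub[OF openV cover(3)] connV conn[OF facts(2)] cover(2,3)
    by (simp_all only: connectedin_subtopology simp_thms)
  have C': "C \<in> connected_components_of ?X" using C by (simp add: sphere_complement_components_def)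
  have "C \<noteq> {}" "C \<subseteq> ?U \<union> ?V"
    using nonempty_connected_components_of[OF C'] connected_components_of_subset[OF C'] cover(1) by auto
  then have "C \<inter> ?U \<noteq> {} \<or> C \<inter> ?V \<noteq> {}"
    by (metis Int_Un_distrib Un_empty inf.absorb1)
  then consider "C \<inter> ?U \<noteq> {}" | "C \<inter> ?V \<noteq> {}" by (elim disjE)
  then show ?thesis
  proof cases
    case 1
    then have "C = ?U"
      by (rule connected_component_eq_clopen_part[OF sub(1,3,2) disj cover(1) C'])
    then show ?thesis by auto
  next
    case 2
    have "?V \<inter> ?U = {}" "topspace ?X = ?V \<union> ?U"
      using disj cover(1) by (simp_all only: Int_commute Un_commute)
    from connected_component_eq_clopen_part[OF sub(2,4,1) this C' 2] have "C = ?V" .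
    then show ?thesis by auto
  qed
qed

section \<open>Approximation of a Jordan curve by Julia sets\<close>

lemma closed_nbhdI: "y \<in> X \<Longrightarrow> dist y z \<le> e \<Longrightarrow> z \<in> closed_nbhd e X"
  by (auto simp: closed_nbhd_def)

lemma subset_closed_nbhd: "X \<subseteq> Y \<Longrightarrow> 0 \<le> e \<Longrightarrow> X \<subseteq> closed_nbhd e Y"
  by (auto simp: closed_nbhd_def)

text \<open>
  Exterior points at a definite distance \<open>\<eta>\<close> from \<open>J\<close> still come close to every point of \<open>J\<close>: finitely
  many exterior points suffice to approximate the compact set \<open>J\<close>.
\<close>

lemma outside_approximates_curve:
  fixes c :: "real \<Rightarrow> complex"
  assumes c: "simple_path c" "pathfinish c = pathstart c" "path_image c = J" and "e > 0"
  obtains \<eta> where "0 < \<eta>" "\<eta> \<le> e"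
    and "\<And>w. w \<in> J \<Longrightarrow> \<exists>q\<in>outside J. \<eta> \<le> infdist q J \<and> dist w q < e"
proof -
  note facts = Jordan_facts[OF c]
  have "J \<subseteq> (\<Union>q\<in>outside J. ball q e)"
  proof
    fix w assume "w \<in> J"
    then have "w \<in> closure (outside J)" by (metis Diff_iff facts(8) frontier_def)
    then show "w \<in> (\<Union>q\<in>outside J. ball q e)"
      using \<open>e > 0\<close> by (auto simp: closure_approachable)
  qed
  then obtain T where T: "T \<subseteq> outside J" "finite T" "J \<subseteq> (\<Union>q\<in>T. ball q e)"
    using compactE_image[OF facts(9), of "outside J" "\<lambda>q. ball q e"] by auto
  define \<eta> where "\<eta> = Min (insert e ((\<lambda>q. infdist q J) ` T))"
  show ?thesis
  proof
    have "infdist q J > 0" if "q \<in> T" for q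
      using that T(1) facts(10) compact_imp_closed[OF facts(9)]
      by (intro infdist_pos_not_in_closed) (auto simp: outside_inside)
    then show "0 < \<eta>" using T(2) \<open>e > 0\<close> by (auto simp: \<eta>_def)
    show "\<eta> \<le> e" using T(2) by (auto simp: \<eta>_def)
    fix w assume "w \<in> J"
    then obtain q where "q \<in> T" "dist w q < e" using T(3) by (auto simp: dist_commute)
    moreover have "\<eta> \<le> infdist q J" using \<open>q \<in> T\<close> T(2) by (auto simp: \<eta>_def)
    ultimately show "\<exists>q\<in>outside J. \<eta> \<le> infdist q J \<and> dist w q < e" using T(1) by blast
  qed
qed

theorem theorem2p2:
  fixes J :: "complex set" and \<delta> :: real and Inn Out :: "riemann_sphere set"
  assumes "jordan_curve J" and "\<delta> > 0"
    and "Inn \<in> sphere_complement_components J" and "None \<notin> Inn" and "bounded (finite_part Inn)"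
    and "Out \<in> sphere_complement_components J" and "None \<in> Out"
  shows "\<exists>p :: complex poly.
           infinity_attracting (poly_map p) \<and>
           hausdorff_dist (finite_part Inn) (finite_part (filled_julia (poly_map p))) < ereal \<delta> \<and>
           hausdorff_dist J (finite_part (julia (poly_map p))) < ereal \<delta> \<and>
           hausdorff_dist_infinity Out (basin_infinity (poly_map p)) < ereal \<delta>"
proof -
  obtain c where c: "simple_path c" "pathfinish c = pathstart c" "path_image c = J"
    using assms(1) by (auto simp: jordan_curve_def)
  note facts = Jordan_facts[OF c]
  have Inn: "finite_part Inn = inside J"
    using Jordan_sphere_components[OF c assms(3)] assms(4) by (auto simp: finite_part_def)
  have Out: "Out = insert None (Some ` outside J)"
    using Jordan_sphere_components[OF c assms(6)] assms(7) by simp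
  define e where "e = \<delta> / 2"
  have e: "0 < e" "0 < e / 2" "ereal e < ereal \<delta>" using assms(2) by (auto simp: e_def)
  obtain \<eta> where \<eta>: "0 < \<eta>" "\<eta> \<le> e / 2"
    and dense: "\<And>w. w \<in> J \<Longrightarrow> \<exists>q\<in>outside J. \<eta> \<le> infdist q J \<and> dist w q < e / 2"
    using outside_approximates_curve[OF c e(2)] by metis
  \<comment> \<open>Points outside \<open>J\<close> at a definite distance from it are made to escape.\<close>
  define G where "G = {z \<in> outside J. \<eta> \<le> infdist z J}"
  have "G = - inside J \<inter> {z. \<eta> \<le> infdist z J}"
    using \<eta> by (auto simp: G_def outside_inside)
  moreover have "closed {z. \<eta> \<le> infdist z J}"
    by (intro closed_Collect_le continuous_intros)
  ultimately have "closed G" using facts(1) by auto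
  have attain: "\<exists>j\<in>J. dist z j = infdist z J" for z
    using infdist_attains_inf[OF compact_imp_closed[OF facts(9)] facts(10)] by metis
  have "bounded (inside J \<union> J)" by (rule compact_imp_bounded[OF compact_closed_Jordan_domain[OF c]])
  then obtain B where B: "B > 0" "\<And>z. z \<in> inside J \<union> J \<Longrightarrow> norm z \<le> B"
    unfolding bounded_pos by auto
  have far: "z \<in> G" if "norm z > B + \<eta>" for z
  proof -
    obtain j where j: "j \<in> J" "dist z j = infdist z J" using attain by blast
    have "norm z - norm j \<le> dist z j" by (simp add: dist_norm norm_triangle_ineq2)
    moreover have "norm j \<le> B" "z \<notin> inside J \<union> J" using B(2) j that \<eta>(1) by force+
    ultimately show ?thesis using that j by (auto simp: G_def outside_inside)
  qed
  obtain p where p: "degree p \<ge> 2"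
    and trapped: "\<And>z. z \<in> inside J \<union> J \<Longrightarrow> Some z \<notin> basin_infinity (poly_map p)"
    and escapes: "\<And>z. z \<in> G \<Longrightarrow> Some z \<in> basin_infinity (poly_map p)"
    using polynomial_with_prescribed_basin[OF c \<open>closed G\<close> _ far] by (auto simp: G_def)
  define K where "K = finite_part (filled_julia (poly_map p))"
  have K: "z \<in> K \<longleftrightarrow> Some z \<notin> basin_infinity (poly_map p)" for z
    by (simp add: K_def finite_part_def filled_julia_def)
  have inside_near: "\<exists>i\<in>inside J. dist i j < e / 2" if "j \<in> J" for j
  proof -
    have "j \<in> closure (inside J)" using that by (metis Diff_iff facts(7) frontier_def)
    then show ?thesis using e(2) unfolding closure_approachable by blast
  qed
  \<comment> \<open>The fate of an orbit is undetermined only for starting points close to \<open>J\<close>.\<close>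
  have gap: "\<exists>j\<in>J. dist z j \<le> e / 2" if "z \<notin> inside J" "z \<notin> G" for z
  proof (cases "z \<in> J")
    case False
    then have "infdist z J < \<eta>" using that by (auto simp: G_def outside_inside)
    then show ?thesis using attain[of z] \<eta>(2) by force
  qed (use e in force)
  have filled: "hausdorff_dist (inside J) K \<le> ereal e"
  proof (rule hausdorff_dist_le)
    show "inside J \<subseteq> closed_nbhd e K"
      using trapped e by (intro subset_closed_nbhd) (auto simp: K)
    show "K \<subseteq> closed_nbhd e (inside J)"
    proof
      fix z assume "z \<in> K"
      show "z \<in> closed_nbhd e (inside J)"
      proof (cases "z \<in> inside J")
        case False
        then obtain j where "j \<in> J" "dist z j \<le> e / 2" using gap escapes \<open>z \<in> K\<close> K by blast
        moreover obtain i where "i \<in> inside J" "dist i j < e / 2" using inside_near \<open>j \<in> J\<close> by blast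
        ultimately have "dist i z \<le> e" using dist_triangle2[of i z j] by linarith
        then show ?thesis using \<open>i \<in> inside J\<close> by (rule closed_nbhdI[rotated])
      qed (use e in \<open>auto intro: closed_nbhdI[of z]\<close>)
    qed
  qed fact
  have boundary: "hausdorff_dist J (frontier K) \<le> ereal e"
  proof (rule hausdorff_dist_le)
    show "J \<subseteq> closed_nbhd e (frontier K)"
    proof
      fix w assume w: "w \<in> J"
      obtain q where q: "q \<in> G" "dist w q < e / 2" using dense[OF w] by (auto simp: G_def)
      \<comment> \<open>A small disc about \<open>w\<close> contains both trapped and escaping points, so it meets the Julia set.\<close>
      have "w \<in> ball w (e / 2) \<inter> K" using w trapped K e by auto
      moreover have "q \<in> ball w (e / 2) - K" using q escapes K by auto
      ultimately have "ball w (e / 2) \<inter> frontier K \<noteq> {}"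
        by (intro connected_Int_frontier connected_ball) blast+
      then obtain x where "x \<in> frontier K" "dist x w < e / 2" by (auto simp: dist_commute)
      then show "w \<in> closed_nbhd e (frontier K)" using e by (intro closed_nbhdI[of x]) auto
    qed
    show "frontier K \<subseteq> closed_nbhd e J"
    proof
      fix z assume z: "z \<in> frontier K"
      have "inside J \<subseteq> interior K"
        using trapped K facts(1) by (intro interior_maximal) auto
      then have zn: "z \<notin> inside J" using z by (auto simp: frontier_def)
      have "z \<in> closure K" using z by (simp add: frontier_def)
      then obtain k where k: "k \<in> K" "dist k z < e / 2"
        using e(2) unfolding closure_approachable by blast
      \<comment> \<open>The nearby trapped point \<open>k\<close> is either separated from \<open>z\<close> by \<open>J\<close> or itself close to \<open>J\<close>.\<close>
      have "\<exists>j\<in>J. dist j z \<le> e"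
      proof (cases "k \<in> inside J")
        case True
        have "k \<in> ball z (e / 2)" "z \<in> ball z (e / 2)" using k e by (auto simp: dist_commute)
        then have "ball z (e / 2) \<inter> frontier (inside J) \<noteq> {}"
          using True zn by (intro connected_Int_frontier connected_ball) blast+
        then obtain j where "j \<in> J" "dist j z < e / 2"
          using facts(7) by (auto simp: dist_commute)
        then show ?thesis using e by force
      next
        case False
        then obtain j where j: "j \<in> J" "dist k j \<le> e / 2" using gap escapes k K by blast
        then have "dist j z \<le> e" using k dist_triangle3[of j z k] by linarith
        then show ?thesis using j by blast
      qed
      then show "z \<in> closed_nbhd e J" by (auto intro: closed_nbhdI)
    qed
  qed fact
  have basin: "hausdorff_dist_infinity Out (basin_infinity (poly_map p)) \<le> ereal e"
  proof (rule hausdorff_dist_infinity_le)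
    have "None \<in> basin_infinity (poly_map p)" using p by (intro None_in_basin_infinity) simp
    then show "ball_at_infinity (B + \<eta>) \<subseteq> Out \<inter> basin_infinity (poly_map p)"
      using far escapes unfolding Out by (auto simp: ball_at_infinity_def G_def)
    have sub: "z \<in> outside J" if "Some z \<in> basin_infinity (poly_map p)" for z
      using that trapped by (auto simp: outside_inside)
    show "\<forall>\<^sub>F R in at_top. hausdorff_dist (finite_part (Out - ball_at_infinity R))
            (finite_part (basin_infinity (poly_map p) - ball_at_infinity R)) \<le> ereal e"
      using eventually_ge_at_top[of "B + e"]
    proof eventually_elim
      case (elim R)
      have Out_R: "finite_part (Out - ball_at_infinity R) = {z \<in> outside J. norm z \<le> R}"
        by (auto simp: finite_part_truncate Out)
      show ?case
        unfolding finite_part_truncate[of "basin_infinity _"] Out_R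
      proof (rule hausdorff_dist_le)
        show "{z. Some z \<in> basin_infinity (poly_map p) \<and> norm z \<le> R}
            \<subseteq> closed_nbhd e {z \<in> outside J. norm z \<le> R}"
          using sub e by (intro subset_closed_nbhd) auto
        show "{z \<in> outside J. norm z \<le> R}
            \<subseteq> closed_nbhd e {z. Some z \<in> basin_infinity (poly_map p) \<and> norm z \<le> R}"
        proof
          fix z assume z: "z \<in> {z \<in> outside J. norm z \<le> R}"
          have "\<exists>q\<in>G. norm q \<le> R \<and> dist q z \<le> e"
          proof (cases "z \<in> G")
            case False
            have "z \<notin> inside J" using z by (auto simp: outside_inside)
            then obtain j where j: "j \<in> J" "dist z j \<le> e / 2" using gap False by blast
            obtain q where q: "q \<in> G" "dist j q < e / 2" using dense[OF j(1)] by (auto simp: G_def)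
            have "dist q z \<le> e"
              using dist_triangle[of z q j] j(2) q(2) by (simp add: dist_commute)
            moreover have "norm q \<le> norm j + dist j q"
              using norm_triangle_sub[of q j] by (simp add: dist_norm norm_minus_commute)
            then have "norm q \<le> R" using B(2)[of j] j(1) q(2) elim e by auto
            ultimately show ?thesis using q by blast
          qed (use z e in force)
          then show "z \<in> closed_nbhd e {z. Some z \<in> basin_infinity (poly_map p) \<and> norm z \<le> R}"
            using escapes by (auto intro: closed_nbhdI)
        qed
      qed fact
    qed
  qed
  have "finite_part (julia (poly_map p)) = frontier K"
    by (simp add: julia_def finite_part_frontier_of K_def)
  then show ?thesis
    using infinity_attracting_poly_map[OF p] filled boundary basin e(3) Inn
    unfolding K_def by (intro exI[of _ p]) (auto intro: le_less_trans)
qed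

end
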